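(* Let $k\ge2$ and $b\ge3$ be integers and let $K$ be the set of numbers in $[0,1]$ having a base-$b$ expansion using only the digits $0$ and $1$. Assume $\Psi:\mathbb{N}\to\mathbb{R}_{>0}$ satisfies $\Psi(x)<\frac12x^{-1}$ for all sufficiently large $x$ and $\Psi(lx)\le l\Psi(x)$ for all $l,x\in\mathbb{N}$. Then the set $$\Big(\mathscr{K}_k(\Psi)\setminus\bigcup_{c<\frac{1}{b-1}}\mathscr{K}_k(c\Psi)\Big)\cap K$$ is uncountable. The same holds with $\mathscr{K}_k$ replaced by $\mathscr{K}_k^{\ast}$, and then the condition $\Psi(lx)\le l\Psi(x)$ may be dropped.
   Context: $\mathbb{N}=\{1,2,\dots\}$; $\mathscr{C}_k$ = reals not algebraic of degree $\le k$; $\mathscr{K}_k(\Psi)=\{\zeta\in\mathscr{C}_k:\max_{1\le j\le k}|\zeta^jq-p_j|\le\Psi(q)$ for infinitely many $(q,p_1,\dots,p_k)\in\mathbb{N}\times\mathbb{Z}^k\}$, and $\mathscr{K}_k^{\ast}(\Psi)$ is the same counting only vectors with $\gcd(q,p_1,\dots,p_k)=1$. The union is over all real $c<1/(b-1)$. *)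

theory Defs
  imports
    Complex_Main
    "HOL-Library.FuncSet"
    "HOL-Library.Countable_Set"
    "HOL-Computational_Algebra.Polynomial"
begin

text \<open>The degree over the rationals of an algebraic number, with integral coefficients
  as in the library definition of \<^const>\<open>algebraic\<close>. The value is
  meaningful only for algebraic arguments.\<close>

definition algebraic_degree :: "real \<Rightarrow> nat" where
  "algebraic_degree x =
     (LEAST n. \<exists>P :: real poly.
        (\<forall>i. coeff P i \<in> \<int>) \<and> P \<noteq> 0 \<and> degree P = n \<and> poly P x = 0)"

definition non_algebraic_upto :: "nat \<Rightarrow> real set" where
  "non_algebraic_upto k = {\<zeta>. \<not> (algebraic \<zeta> \<and> algebraic_degree \<zeta> \<le> k)}"

text \<open>A vector in \<open>\<nat> \<times> \<int>\<^sup>k\<close>, with \<open>\<nat>\<close> starting at 1, is a pair of \<open>q \<ge> 1\<close> and a function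
  on \<open>{1..k}\<close>; extensionality makes distinct pairs represent distinct vectors, so that
  counting pairs is counting vectors. The function \<open>\<Psi>\<close> is only ever evaluated at
  positive arguments.\<close>

definition approx_vectors ::
    "nat \<Rightarrow> (nat \<Rightarrow> real) \<Rightarrow> real \<Rightarrow> (nat \<times> (nat \<Rightarrow> int)) set" where
  "approx_vectors k \<Psi> \<zeta> =
     {(q, p). q \<ge> 1 \<and> p \<in> {1..k} \<rightarrow>\<^sub>E UNIV \<and>
        (MAX j\<in>{1..k}. \<bar>\<zeta> ^ j * real q - real_of_int (p j)\<bar>) \<le> \<Psi> q}"

definition primitive_vectors :: "nat \<Rightarrow> (nat \<times> (nat \<Rightarrow> int)) set" where
  "primitive_vectors k = {(q, p). Gcd (insert (int q) (p ` {1..k})) = 1}"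

definition approximable :: "nat \<Rightarrow> (nat \<Rightarrow> real) \<Rightarrow> real set" where
  "approximable k \<Psi> = {\<zeta> \<in> non_algebraic_upto k. infinite (approx_vectors k \<Psi> \<zeta>)}"

definition approximable_primitive :: "nat \<Rightarrow> (nat \<Rightarrow> real) \<Rightarrow> real set" where
  "approximable_primitive k \<Psi> =
     {\<zeta> \<in> non_algebraic_upto k. infinite (approx_vectors k \<Psi> \<zeta> \<inter> primitive_vectors k)}"

definition cantor_01 :: "nat \<Rightarrow> real set" where
  "cantor_01 b =
     {x \<in> {0..1}. \<exists>d :: nat \<Rightarrow> nat. (\<forall>i. d i \<in> {0, 1}) \<and>
        (\<lambda>i. real (d i) / real b ^ (i + 1)) sums x}"

end

theory Submission imports Defs begin

text \<open>Write \<open>\<eta>(N) = \<Psi>(b\<^bsup>kN\<^esup>) / b\<^bsup>kN\<^esup>\<close>. The number \<open>\<zeta>\<close> is built in blocks of digits ending at positions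
  \<open>N\<^sub>0 < N\<^sub>1 < \<dots>\<close>, with the digit 1 at each \<open>N\<^sub>i\<close>, so that the truncation \<open>P\<^sub>i / b\<^bsup>N\<^sub>i\<^esup>\<close> is a reduced fraction
  whose distance from \<open>\<zeta>\<close> is at most \<open>\<eta>(N\<^sub>i)\<close> and asymptotically at least \<open>\<eta>(N\<^sub>i) / (b - 1)\<close>. As
  \<open>0 \<le> \<zeta> \<le> 1/2\<close>, the \<open>j\<close>-th powers are no further apart than \<open>\<zeta>\<close> and the truncation, and clearing
  denominators with \<open>q = b\<^bsup>k N\<^sub>i\<^esup>\<close> gives primitive approximation vectors for \<open>\<Psi>\<close>.

  Conversely, \<open>\<Psi>(q) < 1/(2q)\<close> forces every approximation vector with large \<open>q\<close> to be an integer
  multiple \<open>l (w\<^sup>k, u w\<^bsup>k-1\<^esup>, \<dots>, u\<^sup>k)\<close> for a reduced fraction \<open>u / w\<close> that is within \<open>1/(4 w\<^sup>4)\<close> of \<open>\<zeta>\<close>,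
  and \<open>N\<^bsub>i+1\<^esub>\<close> is small enough in terms of \<open>\<eta>(N\<^sub>i)\<close> that such a fraction is one of the truncations. The
  lower bound on the distance then excludes every \<open>c < 1 / (b - 1)\<close>. One digit in each block is free and
  does not influence the positions \<open>N\<^sub>i\<close>, which gives uncountably many \<open>\<zeta>\<close>, and only countably many of
  them are algebraic.\<close>

section \<open>Countability of the algebraic numbers\<close>

text \<open>Integer polynomials are encoded by their coefficient lists, of which there are countably
  many, and each nonzero one has finitely many roots.\<close>

lemma countable_algebraic: "countable {x :: real. algebraic x}"
proof -
  let ?R = "\<lambda>xs :: int list. {x :: real. poly (Poly (map of_int xs)) x = 0}"
  have "{x :: real. algebraic x} \<subseteq> (\<Union>xs\<in>{xs. Poly (map of_int xs) \<noteq> (0 :: real poly)}. ?R xs)"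
  proof
    fix x :: real
    assume "x \<in> {x. algebraic x}"
    then obtain p where p: "\<And>i. coeff p i \<in> \<int>" "p \<noteq> 0" "poly p x = 0"
      unfolding algebraic_def by blast
    have "of_int \<lfloor>c\<rfloor> = c" if "c \<in> set (coeffs p)" for c
    proof -
      have "c \<in> \<int>"
        using that p(1) by (auto simp: coeffs_def split: if_splits)
      then show ?thesis
        by (auto elim: Ints_cases)
    qed
    then have "map of_int (map floor (coeffs p)) = coeffs p"
      by (simp add: map_idI)
    then have "Poly (map of_int (map floor (coeffs p))) = p"
      by simp
    with p show "x \<in> (\<Union>xs\<in>{xs. Poly (map of_int xs) \<noteq> (0 :: real poly)}. ?R xs)"
      by (metis (mono_tags, lifting) UN_I mem_Collect_eq)
  qed
  moreover have "countable (\<Union>xs\<in>{xs. Poly (map of_int xs) \<noteq> (0 :: real poly)}. ?R xs)"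
    by (intro countable_UN) (auto intro: countable_finite poly_roots_finite)
  ultimately show ?thesis
    by (rule countable_subset)
qed

lemma uncountable_UNIV_nat_set: "uncountable (UNIV :: nat set set)"
proof
  assume "countable (UNIV :: nat set set)"
  then have "range (from_nat_into (UNIV :: nat set set)) = UNIV"
    by (intro range_from_nat_into) auto
  then show False
    using Cantors_theorem[of "UNIV :: nat set"] by (metis Pow_UNIV)
qed

section \<open>Base \<open>b\<close> expansions with digits 0 and 1\<close>

text \<open>\<open>X\<close> is the set of positions that carry the digit 1. Positions count from 1,
  so whether 0 belongs to \<open>X\<close> has no influence on the value.\<close>

definition digit_sum :: "nat \<Rightarrow> nat set \<Rightarrow> nat \<Rightarrow> real" where
  "digit_sum b X n = (\<Sum>i<n. of_bool (Suc i \<in> X) / real b ^ Suc i)"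

definition digit_val :: "nat \<Rightarrow> nat set \<Rightarrow> real" where
  "digit_val b X = (\<Sum>i. of_bool (Suc i \<in> X) / real b ^ Suc i)"

lemma sums_inverse_powers_tail:
  assumes "b \<ge> 2"
  shows "(\<lambda>i. 1 / real b ^ Suc (i + n)) sums (1 / ((real b - 1) * real b ^ n))"
proof -
  have "(\<lambda>i. 1 / real b ^ Suc n * (1 / real b) ^ i) sums (1 / real b ^ Suc n * (1 / (1 - 1 / real b)))"
    using assms by (intro sums_mult geometric_sums) auto
  also have "(\<lambda>i. 1 / real b ^ Suc n * (1 / real b) ^ i) = (\<lambda>i. 1 / real b ^ Suc (i + n))"
    by (simp add: power_add power_divide mult_ac)
  also have "1 / real b ^ Suc n * (1 / (1 - 1 / real b)) = 1 / ((real b - 1) * real b ^ n)"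
    using assms by (simp add: field_simps)
  finally show ?thesis .
qed

lemma digit_val_sums:
  assumes "b \<ge> 2"
  shows "(\<lambda>i. of_bool (Suc i \<in> X) / real b ^ Suc i) sums digit_val b X"
proof -
  have "summable (\<lambda>i. 1 / real b ^ Suc i)"
    using sums_inverse_powers_tail[OF assms, of 0] by (simp add: sums_iff)
  then have "summable (\<lambda>i. of_bool (Suc i \<in> X) / real b ^ Suc i)"
    by (rule summable_comparison_test') auto
  then show ?thesis
    unfolding digit_val_def by (rule summable_sums)
qed

lemma digit_val_bounds:
  assumes "b \<ge> 2"
  shows "digit_sum b X n \<le> digit_val b X"
    and "digit_val b X \<le> digit_sum b X n + 1 / ((real b - 1) * real b ^ n)"
proof -
  let ?f = "\<lambda>i. of_bool (Suc i \<in> X) / real b ^ Suc i"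
  have tail: "(\<lambda>i. ?f (i + n)) sums (digit_val b X - digit_sum b X n)"
    unfolding digit_sum_def by (rule sums_split_initial_segment[OF digit_val_sums[OF assms]])
  have "0 \<le> digit_val b X - digit_sum b X n"
    by (rule sums_le[OF _ sums_zero tail]) simp
  then show "digit_sum b X n \<le> digit_val b X" by simp
  have "digit_val b X - digit_sum b X n \<le> 1 / ((real b - 1) * real b ^ n)"
    by (rule sums_le[OF _ tail sums_inverse_powers_tail[OF assms]]) (simp add: divide_right_mono)
  then show "digit_val b X \<le> digit_sum b X n + 1 / ((real b - 1) * real b ^ n)" by simp
qed

lemma digit_sum_diff:
  assumes "m \<le> n"
  shows "digit_sum b X n = digit_sum b X m + (\<Sum>i\<in>X \<inter> {m<..n}. 1 / real b ^ i)"
proof -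
  have "digit_sum b X n = digit_sum b X m + (\<Sum>i=m..<n. of_bool (Suc i \<in> X) / real b ^ Suc i)"
    unfolding digit_sum_def using assms
    unfolding lessThan_atLeast0 by (intro sum.atLeastLessThan_concat[symmetric]) auto
  also have "(\<Sum>i=m..<n. of_bool (Suc i \<in> X) / real b ^ Suc i)
      = (\<Sum>i\<in>{m<..n}. of_bool (i \<in> X) / real b ^ i)"
    by (rule sum.reindex_bij_witness[of _ "\<lambda>i. i - 1" Suc]) auto
  also have "\<dots> = (\<Sum>i\<in>X \<inter> {m<..n}. 1 / real b ^ i)"
    by (rule sum.mono_neutral_cong_right) auto
  finally show ?thesis .
qed

text \<open>At the first position \<open>m\<close> where two sets differ, the digit 1 contributes
  \<open>1 / b ^ m\<close>, which for \<open>b \<ge> 3\<close> exceeds every possible tail beyond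
  \<open>m\<close>, namely at most \<open>1 / ((b - 1) * b ^ m)\<close>.\<close>

lemma inj_digit_val:
  assumes "b \<ge> 3"
  shows "inj_on (digit_val b) (Pow {0<..})"
proof -
  have less: "digit_val b Y < digit_val b X"
    if m: "m \<in> X" "m \<notin> Y" "0 < m" and eq: "\<And>i. i < m \<Longrightarrow> i \<in> X \<longleftrightarrow> i \<in> Y" for X Y m
  proof -
    obtain n where n: "m = Suc n" using m(3) by (cases m) auto
    have "digit_sum b X n = digit_sum b Y n"
      unfolding digit_sum_def using eq n by (intro sum.cong) auto
    moreover have "digit_sum b X m = digit_sum b X n + 1 / real b ^ m"
      and "digit_sum b Y m = digit_sum b Y n"
      using m n by (auto simp: digit_sum_def)
    moreover have "1 / ((real b - 1) * real b ^ m) < 1 / real b ^ m"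
      using assms by (simp add: field_simps)
    ultimately show ?thesis
      using digit_val_bounds(1)[of b X m] digit_val_bounds(2)[of b Y m] assms by simp
  qed
  show ?thesis
  proof (rule inj_onI, rule ccontr)
    fix X Y assume X: "X \<in> Pow {0<..}" and Y: "Y \<in> Pow {0<..}"
      and val: "digit_val b X = digit_val b Y" and "X \<noteq> Y"
    then have ex: "\<exists>m. (m \<in> X) \<noteq> (m \<in> Y)" by auto
    define m where "m = (LEAST m. (m \<in> X) \<noteq> (m \<in> Y))"
    have m: "(m \<in> X) \<noteq> (m \<in> Y)" unfolding m_def by (rule LeastI_ex[OF ex])
    have eq: "i \<in> X \<longleftrightarrow> i \<in> Y" if "i < m" for i
      using not_less_Least that unfolding m_def by blast
    have "0 < m" using m X Y by auto
    then show False
      using less[of m X Y] less[of m Y X] m eq val by force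
  qed
qed

primrec digit_num :: "nat \<Rightarrow> nat set \<Rightarrow> nat \<Rightarrow> nat" where
  "digit_num b X 0 = 0"
| "digit_num b X (Suc n) = b * digit_num b X n + of_bool (Suc n \<in> X)"

lemma digit_sum_eq_digit_num:
  assumes "b > 0"
  shows "digit_sum b X n = real (digit_num b X n) / real b ^ n"
proof (induction n)
  case (Suc n)
  have "digit_sum b X (Suc n) = digit_sum b X n + of_bool (Suc n \<in> X) / real b ^ Suc n"
    by (simp add: digit_sum_def)
  also have "\<dots> = real (digit_num b X (Suc n)) / real b ^ Suc n"
    using assms by (simp add: Suc.IH add_divide_distrib)
  finally show ?case .
qed (simp add: digit_sum_def)

text \<open>The last digit 1 makes the numerator congruent to 1 modulo \<open>b\<close>.\<close>

lemma coprime_digit_num: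
  assumes "n \<in> X" "0 < n"
  shows "coprime (digit_num b X n) b"
proof -
  obtain m where "n = Suc m" using assms(2) by (cases n) auto
  then have "digit_num b X n = b * digit_num b X m + 1"
    using assms(1) by simp
  then show ?thesis
    by (metis coprime_def dvd_add_right_iff dvd_mult2)
qed

lemma digit_val_in_cantor_01:
  assumes "b \<ge> 3"
  shows "digit_val b X \<in> {0..1/2}" "digit_val b X \<in> cantor_01 b"
proof -
  have "1 / (real b - 1) \<le> 1 / 2"
    using assms by (simp add: field_simps)
  then show *: "digit_val b X \<in> {0..1/2}"
    using digit_val_bounds[of b X 0] assms by (simp add: digit_sum_def del: le_divide_eq_numeral1)
  have "(\<lambda>i. real (of_bool (Suc i \<in> X)) / real b ^ (i + 1)) sums digit_val b X"
    using digit_val_sums[of b X] assms by simp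
  with * show "digit_val b X \<in> cantor_01 b"
    unfolding cantor_01_def by (auto intro!: exI[of _ "\<lambda>i. of_bool (Suc i \<in> X)"])
qed

section \<open>Construction of a single block of digits\<close>

text \<open>The positions \<open>L - 1\<close> and \<open>L\<close> are kept out of \<open>Y\<close>: position \<open>L\<close> will carry the digit 1,
  so that the truncation there is a reduced fraction, and position \<open>L - 1\<close> is left free. The
  factor \<open>1 / (b - 1)\<close> is the worst ratio to \<open>\<eta>\<close> of the largest digit sum not exceeding \<open>\<eta>\<close>; it is
  approached when \<open>\<eta>\<close> lies just below a power of \<open>1 / b\<close>.\<close>

lemma block_exists:
  fixes b N :: nat and \<eta> :: real
  assumes b: "b \<ge> 3" and N: "N \<ge> 1" and \<eta>: "0 < \<eta>" "\<eta> < 1 / real b ^ (4 * N)"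
  obtains L Y where "Y \<subseteq> {N<..<L - 1}" "N + 2 \<le> L"
    "(\<Sum>i\<in>Y. 1 / real b ^ i) + 2 * real b / real b ^ L \<le> \<eta>"
    "\<eta> - 2 * real b ^ 2 / real b ^ L \<le> (real b - 1) * (\<Sum>i\<in>Y. 1 / real b ^ i)"
    "1 / real b ^ L \<le> \<eta>\<^sup>2" "\<eta>\<^sup>2 \<le> real b ^ 2 / real b ^ L"
proof -
  have exM: "\<exists>M>N'. 1 / real b ^ M \<le> x \<and> x < b / real b ^ M"
    if x: "0 < x" "x < 1 / real b ^ N'" for x :: real and N'
  proof -
    have "\<exists>M. 1 / real b ^ M \<le> x"
      using real_arch_pow_inv[OF x(1), of "1 / real b"] b
      by (auto simp: power_divide intro: less_imp_le)
    then have M: "1 / real b ^ (LEAST M. 1 / real b ^ M \<le> x) \<le> x" (is "1 / _ ^ ?M \<le> _")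
      by (rule LeastI_ex)
    have gt: "x < 1 / real b ^ m" if "m < ?M" for m
      using not_less_Least[OF that] by simp
    have "1 / real b ^ ?M < 1 / real b ^ N'"
      using M x by simp
    then have "N' < ?M"
      using b by (simp add: field_simps)
    moreover have "x < b / real b ^ ?M"
      using gt[of "?M - 1"] \<open>N' < ?M\<close> b by (cases ?M) auto
    ultimately show ?thesis using M by blast
  qed
  obtain M0 where M0: "4 * N < M0" "1 / real b ^ M0 \<le> \<eta>" "\<eta> < b / real b ^ M0"
    using exM[OF \<eta>] by blast
  \<comment> \<open>Doubling \<open>M0\<close> makes \<open>1 / b ^ L\<close> comparable to
    \<open>\<eta>\<^sup>2\<close>: negligible against \<open>\<eta>\<close>, yet not so small that
    the next truncation comes too late.\<close>
  define L where "L = 2 * M0"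
  have bL: "real b ^ L = real b ^ M0 * real b ^ M0"
    by (simp add: L_def mult_2 power_add)
  have b3: "3 \<le> real b" using b by simp
  \<comment> \<open>The reserve \<open>2 * b / b ^ L\<close> is for the digits at
    \<open>L - 1\<close> and \<open>L\<close> and the tail beyond \<open>L\<close>, which total at
    most \<open>(b + 2) / b ^ L\<close>.\<close>
  define \<eta>' where "\<eta>' = \<eta> - 2 * real b / real b ^ L"
  have "real b ^ 3 \<le> real b ^ M0"
    using M0(1) N b by (intro power_increasing) auto
  moreover have "9 * real b \<le> real b ^ 3"
    using b3 mult_mono[of 3 "real b" 3 "real b"] by (simp add: power3_eq_cube)
  ultimately have "2 * real b * 3 \<le> 2 * real b ^ M0"
    using b3 by linarith
  then have "2 * real b / real b ^ L \<le> 2 / 3 / real b ^ M0"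
    unfolding bL using b3 by (simp add: field_simps)
  moreover have "1 / real b ^ Suc M0 \<le> 1 / 3 / real b ^ M0"
    using b3 by (simp add: field_simps)
  ultimately have \<eta>'_lower: "1 / real b ^ Suc M0 \<le> \<eta>'"
    unfolding \<eta>'_def using M0(2) by (simp add: field_simps)
  have "0 < 1 / real b ^ Suc M0" using b3 by simp
  then have "0 < \<eta>'" using \<eta>'_lower by linarith
  have "\<eta>' < \<eta>" unfolding \<eta>'_def using b3 by simp
  then have "\<eta>' < 1 / real b ^ (4 * N)" using \<eta>(2) by simp
  then obtain M where M: "4 * N < M" "1 / real b ^ M \<le> \<eta>'" "\<eta>' < b / real b ^ M"
    using exM[OF \<open>0 < \<eta>'\<close>] by blast
  have "1 / real b ^ Suc M0 < b / real b ^ M" using \<eta>'_lower M(3) by linarith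
  then have "real b ^ M < real b ^ (M0 + 2)"
    using b3 by (simp add: field_simps)
  then have "M < M0 + 2"
    using b3 by (simp only: power_strict_increasing_iff)
  then have M_L: "M + 2 \<le> L" unfolding L_def using M0(1) N by linarith
  have L': "real b ^ L = real b ^ (L - 2) * real b ^ 2"
    using M_L by (metis add_leD2 le_add_diff_inverse2 power_add)
  define R where "R = (\<Sum>i\<in>{M..L-2}. 1 / real b ^ i)"
  have R: "(real b - 1) * R = b / real b ^ M - b ^ 2 / real b ^ L"
  proof -
    have "(real b - 1) * (\<Sum>i\<in>{M..n}. 1 / real b ^ i) = b / real b ^ M - 1 / real b ^ n"
      if "M \<le> n" for n
      using that
    proof (induction n rule: dec_induct)
      case base
      then show ?case using b3 by (simp add: field_simps)
    next
      case (step n)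
      have "(real b - 1) * (1 / real b ^ Suc n) = 1 / real b ^ n - 1 / real b ^ Suc n"
        using b3 by (simp add: field_simps)
      then show ?case using step by (simp add: distrib_left)
    qed
    from this[of "L - 2"] M_L show ?thesis
      unfolding R_def L' using b3 by simp
  qed
  have fin: "1 / real b ^ L \<le> \<eta>\<^sup>2" "\<eta>\<^sup>2 \<le> real b ^ 2 / real b ^ L"
  proof -
    show "1 / real b ^ L \<le> \<eta>\<^sup>2"
      using power_mono[OF M0(2), of 2] by (simp add: bL power_divide power2_eq_square)
    show "\<eta>\<^sup>2 \<le> real b ^ 2 / real b ^ L"
      using power_mono[of \<eta> "b / real b ^ M0" 2] M0(3) \<eta>(1)
      by (simp add: bL power_divide power2_eq_square)
  qed
  have "2 * real b \<le> real b ^ 2" using b3 by (simp add: power2_eq_square)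
  then have bb: "2 * real b / real b ^ L \<le> real b ^ 2 / real b ^ L"
    by (simp add: divide_right_mono)
  have bb2: "2 * real b / real b ^ L \<le> 2 * real b ^ 2 / real b ^ L"
    using \<open>2 * real b \<le> real b ^ 2\<close> b3
    by (intro divide_right_mono zero_le_power) linarith+
  \<comment> \<open>If the full run of ones from \<open>M\<close> to \<open>L - 2\<close> fits under
    \<open>\<eta>'\<close>, it serves, because \<open>(b - 1) * R\<close> is nearly
    \<open>b / b ^ M\<close>, which exceeds \<open>\<eta>'\<close>. Otherwise the single digit at
    \<open>M\<close> serves: \<open>\<eta>' < R\<close> gives
    \<open>(b - 1) * \<eta>' \<le> b / b ^ M\<close>, and \<open>b \<le> (b - 1)\<^sup>2\<close> as
    \<open>b \<ge> 3\<close>.\<close>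
  show ?thesis
  proof (cases "R \<le> \<eta>'")
    case True
    show ?thesis
    proof (rule that[of "{M..L-2}" L])
      show "\<eta> - 2 * real b ^ 2 / real b ^ L \<le> (real b - 1) * (\<Sum>i\<in>{M..L-2}. 1 / real b ^ i)"
        using R M(3) bb unfolding R_def \<eta>'_def by simp
    qed (use True M M_L N fin in \<open>auto simp: R_def \<eta>'_def\<close>)
  next
    case False
    show ?thesis
    proof (rule that[of "{M}" L])
      have "(real b - 1) * \<eta>' \<le> (real b - 1) * R"
        using False b3 by (intro mult_left_mono) auto
      also have "\<dots> \<le> b / real b ^ M"
        unfolding R by simp
      finally have 1: "(real b - 1) * \<eta>' \<le> b * (1 / real b ^ M)" by simp
      have "(real b - 1) * (real b - 2) \<ge> 2 * (real b - 2)"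
        using b3 by (intro mult_right_mono) auto
      then have "b \<le> (real b - 1) * (real b - 1)"
        using b3 by (simp add: algebra_simps)
      then have "b * (1 / real b ^ M) \<le> (real b - 1) * (real b - 1) * (1 / real b ^ M)"
        by (rule mult_right_mono) simp
      with 1 have "(real b - 1) * \<eta>' \<le> (real b - 1) * ((real b - 1) * (1 / real b ^ M))"
        by (simp only: mult.assoc)
      then have "\<eta>' \<le> (real b - 1) * (1 / real b ^ M)"
        by (rule mult_left_le_imp_le) (use b3 in simp)
      then show "\<eta> - 2 * real b ^ 2 / real b ^ L \<le> (real b - 1) * (\<Sum>i\<in>{M}. 1 / real b ^ i)"
        using bb2 unfolding \<eta>'_def by simp
    qed (use M M_L N fin in \<open>auto simp: \<eta>'_def\<close>)
  qed
qed

section \<open>Powers of nearby numbers, and fractions close to \<open>\<zeta>\<close>\<close>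

text \<open>With both numbers at most 1/2 in size, each term of
  \<open>x * (x ^ n - r ^ n) + r ^ n * (x - r)\<close> is at most half of
  \<open>\<bar>x - r\<bar>\<close>. No constant is lost, so the truncations serve for
  \<open>\<Psi>\<close> itself and not just for a multiple of it.\<close>

lemma abs_power_diff_le:
  fixes x r :: real
  assumes "\<bar>x\<bar> \<le> 1/2" "\<bar>r\<bar> \<le> 1/2" "j \<ge> 1"
  shows "\<bar>x ^ j - r ^ j\<bar> \<le> \<bar>x - r\<bar>"
  using assms(3)
proof (induction j rule: dec_induct)
  case (step n)
  have "x ^ Suc n - r ^ Suc n = x * (x ^ n - r ^ n) + r ^ n * (x - r)"
    by (simp add: algebra_simps)
  also have "\<bar>\<dots>\<bar> \<le> \<bar>x\<bar> * \<bar>x ^ n - r ^ n\<bar> + \<bar>r\<bar> ^ n * \<bar>x - r\<bar>"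
    by (metis abs_mult abs_triangle_ineq power_abs)
  also have "\<dots> \<le> 1/2 * \<bar>x - r\<bar> + 1/2 * \<bar>x - r\<bar>"
  proof (intro add_mono mult_mono step.IH assms)
    have "\<bar>r\<bar> ^ n \<le> \<bar>r\<bar> ^ 1"
      using assms step by (intro power_decreasing) auto
    then show "\<bar>r\<bar> ^ n \<le> 1/2" using assms by simp
  qed auto
  finally show ?case by simp
qed simp

text \<open>For a fraction not yet known to be a truncation only
  \<open>\<bar>r\<bar> \<le> 1\<close> is at hand; the same splitting then gives the factor 2, the
  fixed point of \<open>c = c / 2 + 1\<close>.\<close>

lemma abs_power_diff_le_double:
  fixes x r :: real
  assumes "\<bar>x\<bar> \<le> 1/2" "\<bar>r\<bar> \<le> 1"
  shows "\<bar>x ^ j - r ^ j\<bar> \<le> 2 * \<bar>x - r\<bar>"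
proof (induction j)
  case (Suc n)
  have "x ^ Suc n - r ^ Suc n = x * (x ^ n - r ^ n) + r ^ n * (x - r)"
    by (simp add: algebra_simps)
  also have "\<bar>\<dots>\<bar> \<le> \<bar>x\<bar> * \<bar>x ^ n - r ^ n\<bar> + \<bar>r\<bar> ^ n * \<bar>x - r\<bar>"
    by (metis abs_mult abs_triangle_ineq power_abs)
  also have "\<dots> \<le> 1/2 * (2 * \<bar>x - r\<bar>) + 1 * \<bar>x - r\<bar>"
    by (intro add_mono mult_mono Suc.IH assms power_le_one) auto
  finally show ?case by simp
qed simp

text \<open>A fraction \<open>u / w\<close> other than all the truncations is at distance at least
  \<open>1 / (w b\<^sup>N)\<close> from each of them; the last truncation with \<open>b\<^sup>N \<le> 2 w\<^sup>3\<close> gives the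
  contradiction.\<close>

lemma approximant_is_truncation:
  fixes \<zeta> :: real and N :: "nat \<Rightarrow> nat" and P :: "nat \<Rightarrow> int" and \<eta> :: "nat \<Rightarrow> real"
    and u :: int and w b :: nat
  assumes b: "b \<ge> 3" and N: "strict_mono N" "N 0 \<ge> 3"
    and approx: "\<And>i. \<bar>\<zeta> - P i / real b ^ N i\<bar> \<le> \<eta> i"
    and small: "\<And>i. \<eta> i < 1 / (2 * real b ^ (4 * N i))"
    and grow: "\<And>i. (\<eta> i)\<^sup>2 \<le> real b ^ 2 / real b ^ N (Suc i)"
    and w: "w \<ge> b ^ N 0" "\<bar>\<zeta> - u / w\<bar> < 1 / (4 * real w ^ 4)"
  shows "\<exists>i. u / w = P i / real b ^ N i"
proof (rule ccontr)
  assume neq: "\<nexists>i. u / w = P i / real b ^ N i"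
  have b3: "3 \<le> real b" using b by simp
  have "0 < b ^ N 0" using b by simp
  then have w1: "1 \<le> real w" using w(1) by linarith
  have w3: "w ^ 1 \<le> w ^ 3" using w1 by (intro power_increasing) auto
  have "\<exists>j. 2 * w ^ 3 < b ^ N j"
  proof
    have "2 * w ^ 3 \<le> N (2 * w ^ 3)" by (rule strict_mono_imp_increasing[OF N(1)])
    also have "\<dots> < b ^ N (2 * w ^ 3)" using b by (intro power_gt_expt) auto
    finally show "2 * w ^ 3 < b ^ N (2 * w ^ 3)" .
  qed
  then have j: "2 * w ^ 3 < b ^ N (LEAST j. 2 * w ^ 3 < b ^ N j)" (is "_ < _ ^ N ?j")
    by (rule LeastI_ex)
  have "?j \<noteq> 0"
  proof
    assume "?j = 0"
    then have "2 * w ^ 3 < b ^ N 0" using j by metis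
    then show False using w(1) w3 by simp
  qed
  then obtain i where i: "?j = Suc i" by (cases ?j) auto
  have "b ^ N i \<le> 2 * w ^ 3"
    using not_less_Least[of i "\<lambda>j. 2 * w ^ 3 < b ^ N j"] i by simp
  then have "real (b ^ N i) \<le> real (2 * w ^ 3)" by (simp only: of_nat_le_iff)
  moreover have "real (2 * w ^ 3) < real (b ^ N (Suc i))" using j i by (simp only: of_nat_less_iff)
  moreover define B where "B = real b ^ N i"
  moreover define C where "C = real b ^ N (Suc i)"
  ultimately have B: "B \<le> 2 * real w ^ 3" and C: "2 * real w ^ 3 < C" by auto
  have "3 \<le> N i" using N strict_mono_less_eq[OF N(1), of 0 i] by simp
  then have "real b ^ 3 \<le> B" unfolding B_def using b3 by (intro power_increasing) auto
  moreover have "3 * real b ^ 2 \<le> real b ^ 3" using b3 by (simp add: power2_eq_square power3_eq_cube)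
  ultimately have Bb: "2 * real b ^ 2 < B" using b3 zero_less_power[of "real b" 2] by linarith
  then have B0: "0 < B" using b3 zero_le_power[of "real b" 2] by linarith
  define e where "e = \<eta> i"
  have e: "0 \<le> e" using approx[of i] unfolding e_def by linarith
  have "u * b ^ N i - P i * w \<noteq> 0"
  proof
    assume "u * b ^ N i - P i * w = 0"
    then have "real_of_int (u * b ^ N i) = real_of_int (P i * w)" by simp
    then have "u / w = P i / real b ^ N i" using w1 b3 by (simp add: field_simps)
    then show False using neq by blast
  qed
  then have "1 \<le> \<bar>u * b ^ N i - P i * w\<bar>" by linarith
  then have "1 \<le> \<bar>real_of_int (u * b ^ N i - P i * w)\<bar>" by linarith
  then have "1 / (w * B) \<le> \<bar>u * B - P i * w\<bar> / (w * B)"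
    using w1 B0 by (intro divide_right_mono) (auto simp: B_def)
  also have "\<dots> = \<bar>(u * B - P i * w) / (w * B)\<bar>" using w1 B0 by (simp add: abs_mult)
  also have "(u * B - P i * w) / (w * B) = u / w - P i / B" using w1 B0 by (simp add: field_simps)
  also have "\<bar>\<dots>\<bar> < 1 / (4 * real w ^ 4) + e"
    using approx[of i] w(2) unfolding e_def B_def by linarith
  \<comment> \<open>Since \<open>B \<le> 2 * w ^ 3\<close>, the error of \<open>u / w\<close> uses
    up at most half of the separation \<open>1 / (w * B)\<close>; the other half is left to
    \<open>e\<close>.\<close>
  also have "1 / (4 * real w ^ 4) \<le> 1 / (2 * (w * B))"
  proof -
    have "2 * (w * B) \<le> 2 * (w * (2 * real w ^ 3))" using B w1 by (intro mult_left_mono) auto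
    then show ?thesis using w1 B0 by (intro divide_left_mono) (auto simp: power_numeral_reduce)
  qed
  finally have "1 / (2 * (w * B)) < e" by (simp add: field_simps)
  then have e1: "1 < 2 * w * B * e" using w1 B0 by (simp add: field_simps)
  have e2: "2 * B ^ 4 * e < 1"
    using small[of i] b3 unfolding e_def B_def by (simp add: field_simps flip: power_mult)
  have e3: "C * e\<^sup>2 \<le> real b ^ 2"
    using grow[of i] b3 unfolding e_def C_def by (simp add: field_simps)
  \<comment> \<open>The bounds on \<open>e\<close> clash with \<open>e > 1 / (2 * w * B)\<close>:
    the bound \<open>e < 1 / (2 * B ^ 4)\<close> forces \<open>w > B ^ 3\<close>, while
    \<open>C * e\<^sup>2 \<le> b\<^sup>2\<close> with \<open>C > 2 * w ^ 3\<close> forces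
    \<open>w < 2 * B\<^sup>2 * b\<^sup>2\<close>, which is below \<open>B ^ 3\<close> because
    \<open>N i \<ge> 3\<close>.\<close>
  have "B ^ 3 < w"
  proof -
    have "B ^ 3 * 1 < B ^ 3 * (2 * w * B * e)" using e1 B0 by (intro mult_strict_left_mono) auto
    also have "\<dots> = w * (2 * B ^ 4 * e)" by (simp add: power_numeral_reduce)
    also have "\<dots> < real w * 1" using e2 w1 by (intro mult_strict_left_mono) auto
    finally show ?thesis by simp
  qed
  moreover have "w < 2 * B ^ 2 * real b ^ 2"
  proof -
    have "1 < (2 * w * B * e) ^ 2" using e1 by (simp add: one_less_power)
    moreover have "0 < C" using C w1 zero_le_power[of "real w" 3] by linarith
    ultimately have "C < C * (2 * w * B * e) ^ 2" by simp
    also have "\<dots> = (2 * w * B) ^ 2 * (C * e\<^sup>2)" by (simp add: power_mult_distrib)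
    also have "\<dots> \<le> (2 * w * B) ^ 2 * real b ^ 2" using e3 by (intro mult_left_mono) auto
    finally have "2 * real w ^ 3 < (2 * w * B) ^ 2 * real b ^ 2" using C by linarith
    then have "real w ^ 2 * (2 * w) < real w ^ 2 * (4 * B ^ 2 * real b ^ 2)"
      by (simp add: power_numeral_reduce mult_ac)
    then show ?thesis using w1 by simp
  qed
  moreover have "B ^ 2 * (2 * real b ^ 2) < B ^ 2 * B" using Bb B0 by (intro mult_strict_left_mono) auto
  ultimately show False by (simp add: power_numeral_reduce)
qed

section \<open>Approximation vectors and powers of a single fraction\<close>

lemma mem_approx_vectors_iff:
  assumes "k \<ge> 1"
  shows "(q, p) \<in> approx_vectors k \<Psi> \<zeta> \<longleftrightarrow> q \<ge> 1 \<and> p \<in> {1..k} \<rightarrow>\<^sub>E UNIV \<and>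
    (\<forall>j\<in>{1..k}. \<bar>\<zeta> ^ j * real q - real_of_int (p j)\<bar> \<le> \<Psi> q)"
  unfolding approx_vectors_def using assms by (simp add: Max_le_iff)

text \<open>The vectors are \<open>b ^ (k * N i)\<close> times the powers of the truncations. The
  first entry is a power of \<open>b\<close> and the last is \<open>P i ^ k\<close>, coprime to
  \<open>b\<close>, so the gcd is 1; distinct \<open>N i\<close> give distinct vectors.\<close>

lemma infinite_primitive_vectors:
  fixes N P :: "nat \<Rightarrow> nat"
  assumes k: "k \<ge> 1" and b: "b \<ge> 2" and N: "strict_mono N" and \<zeta>: "\<bar>\<zeta>\<bar> \<le> 1/2"
    and P: "\<And>i. coprime (P i) b" "\<And>i. P i / real b ^ N i \<le> \<zeta>"
    and approx: "\<And>i. \<zeta> - P i / real b ^ N i \<le> \<Psi> (b ^ (k * N i)) / real b ^ (k * N i)"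
  shows "infinite (approx_vectors k \<Psi> \<zeta> \<inter> primitive_vectors k)"
proof -
  define F where "F i = (b ^ (k * N i), \<lambda>j\<in>{1..k}. int (P i ^ j * b ^ (N i * (k - j))))" for i
  have "inj F"
    using k b strict_mono_eq[OF N] by (auto simp: F_def inj_def power_inject_exp)
  moreover have "F i \<in> approx_vectors k \<Psi> \<zeta> \<inter> primitive_vectors k" for i
  proof
    define q where "q = b ^ (k * N i)"
    define r where "r = P i / real b ^ N i"
    have q: "0 < real q" unfolding q_def using b by simp
    have "\<bar>\<zeta> ^ j * real q - real_of_int (int (P i ^ j * b ^ (N i * (k - j))))\<bar> \<le> \<Psi> q"
      if j: "j \<in> {1..k}" for j
    proof -
      have "k * N i = N i * j + N i * (k - j)"
        using j by (metis atLeastAtMost_iff distrib_left le_add_diff_inverse mult.commute)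
      then have "real q = real b ^ (N i * j) * real b ^ (N i * (k - j))"
        by (simp add: q_def power_add)
      then have "real (P i ^ j * b ^ (N i * (k - j))) = r ^ j * real q"
        using b by (simp add: r_def power_divide flip: power_mult)
      then have "\<bar>\<zeta> ^ j * real q - real_of_int (int (P i ^ j * b ^ (N i * (k - j))))\<bar>
          = \<bar>\<zeta> ^ j - r ^ j\<bar> * real q"
        by (simp add: abs_mult flip: left_diff_distrib)
      also have "0 \<le> r" "r \<le> \<zeta>" using P(2)[of i] by (simp_all add: r_def)
      then have "\<bar>\<zeta> ^ j - r ^ j\<bar> * real q \<le> \<bar>\<zeta> - r\<bar> * real q"
        using \<zeta> j by (intro mult_right_mono abs_power_diff_le) auto
      also have "\<dots> \<le> \<Psi> q"
        using approx[of i] \<open>r \<le> \<zeta>\<close> q by (simp add: q_def r_def field_simps)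
      finally show ?thesis .
    qed
    then show "F i \<in> approx_vectors k \<Psi> \<zeta>"
      unfolding F_def mem_approx_vectors_iff[OF k] using q by (auto simp: q_def)
    define p where "p = (\<lambda>j\<in>{1..k}. int (P i ^ j * b ^ (N i * (k - j))))"
    let ?g = "Gcd (insert (int q) (p ` {1..k}))"
    have "p k \<in> p ` {1..k}" using k by simp
    moreover have "p k = int (P i ^ k)" using k by (simp add: p_def)
    ultimately have "int (P i ^ k) \<in> insert (int q) (p ` {1..k})" by simp
    then have "?g dvd int q" "?g dvd int (P i ^ k)"
      by (simp_all only: Gcd_dvd insertI1)
    moreover have "coprime (int q) (int (P i ^ k))"
      using P(1)[of i] by (auto simp: q_def coprime_commute simp del: of_nat_power)
    ultimately have "?g dvd 1"
      by (meson coprime_common_divisor)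
    then have "?g = 1" by simp
    then show "F i \<in> primitive_vectors k"
      unfolding F_def primitive_vectors_def p_def q_def by simp
  qed
  ultimately show ?thesis
    by (meson image_subsetI infinite_super range_inj_infinite)
qed

text \<open>Inductively, \<open>p\<^sub>j / q\<close> and \<open>(u / w)\<^sup>j\<close> are closer than \<open>1 / (w q)\<close>, while \<open>w q\<close> is a common
  denominator once \<open>w\<^bsup>j-1\<^esup>\<close> divides \<open>q\<close>.\<close>

lemma approx_vector_structure:
  fixes \<zeta> :: real and p :: "nat \<Rightarrow> int"
  assumes k: "k \<ge> 1" and q: "q \<ge> 1" and \<zeta>: "\<bar>\<zeta>\<bar> \<le> 1/2"
    and approx: "\<And>j. j \<in> {1..k} \<Longrightarrow> \<bar>\<zeta> ^ j * real q - p j\<bar> < 1 / (4 * real q)"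
  obtains u :: int and w l :: nat where "coprime u (int w)" "w \<ge> 1" "l \<ge> 1" "q = l * w ^ k"
    "\<forall>j\<in>{1..k}. p j = int l * u ^ j * int w ^ (k - j)"
proof -
  define g where "g = gcd (p 1) (int q)"
  have g0: "g > 0" using q by (simp add: g_def)
  obtain u W where uW: "p 1 = u * g" "int q = W * g" "coprime u W"
    using gcd_coprime_exists[of "p 1" "int q"] g0 unfolding g_def by auto
  have W0: "W > 0" using uW(2) g0 q by (metis of_nat_0_less_iff less_le_trans zero_less_one zero_less_mult_pos2)
  have W_le_q: "W \<le> int q" using uW(2) g0 W0 by (simp add: mult_le_cancel_left1)
  define r where "r = real_of_int u / real_of_int W"
  have q1: "1 \<le> real q" using q by simp
  define \<tau> where "\<tau> = 1 / (4 * real q ^ 2)"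
  have div_q: "\<bar>\<zeta> ^ j - p j / real q\<bar> < \<tau>" if "j \<in> {1..k}" for j
  proof -
    have "\<zeta> ^ j - p j / real q = (\<zeta> ^ j * real q - p j) / real q"
      using q1 by (simp add: field_simps)
    then have "\<bar>\<zeta> ^ j - p j / real q\<bar> = \<bar>\<zeta> ^ j * real q - p j\<bar> / real q"
      by simp
    also have "\<dots> < 1 / (4 * real q) / real q"
      using approx[OF that] q1 by (intro divide_strict_right_mono) auto
    finally show ?thesis by (simp add: \<tau>_def power2_eq_square)
  qed
  have "real q = real_of_int (W * g)" unfolding uW(2)[symmetric] by simp
  then have "p 1 / real q = r" using uW(1) g0 W0 by (simp add: r_def)
  then have \<zeta>r: "\<bar>\<zeta> - r\<bar> < \<tau>" using div_q[of 1] k by simp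
  have "\<tau> \<le> 1 / 4" using q1 by (simp add: \<tau>_def)
  then have r1: "\<bar>r\<bar> \<le> 1" using \<zeta>r \<zeta> by linarith
  have tri: "\<bar>a - c\<bar> < 3 * t" if "\<bar>x - c\<bar> \<le> 2 * d" "\<bar>x - a\<bar> < t" "d < t" for x a c d t :: real
    using that by linarith
  have main: "W ^ j dvd int q \<and> p j * W ^ j = u ^ j * int q" if "j \<ge> 1" "j \<le> k" for j
    using that
  proof (induction j rule: dec_induct)
    case base
    then show ?case using uW by simp
  next
    case (step n)
    then have Suc_n: "Suc n \<in> {1..k}" by simp
    from step obtain m where m: "int q = W ^ n * m" by (auto elim: dvdE)
    have rm: "real q = real_of_int W ^ n * real_of_int m"
      using m by (metis of_int_mult of_int_of_nat_eq of_int_power)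
    have "\<bar>\<zeta> ^ Suc n - r ^ Suc n\<bar> \<le> 2 * \<bar>\<zeta> - r\<bar>"
      using \<zeta> r1 by (rule abs_power_diff_le_double)
    then have "\<bar>p (Suc n) / real q - r ^ Suc n\<bar> < 3 * \<tau>"
      using div_q[OF Suc_n] \<zeta>r by (rule tri)
    also have "\<dots> \<le> 1 / real q ^ 2" using q1 by (simp add: \<tau>_def divide_simps)
    finally have "\<bar>p (Suc n) / real q - r ^ Suc n\<bar> * (W * real q) < 1 / real q ^ 2 * (W * real q)"
      using W0 q1 by (intro mult_strict_right_mono) auto
    also have "\<dots> = real_of_int W / real q" using q1 by (simp add: power2_eq_square)
    also have "\<dots> \<le> 1" using W_le_q q1 by (simp add: divide_le_eq_1)
    finally have less_1: "\<bar>p (Suc n) / real q - r ^ Suc n\<bar> * (W * real q) < 1" .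
    have "(p (Suc n) / real q - r ^ Suc n) * (W * real q)
        = p (Suc n) / real q * (W * real q) - r ^ Suc n * (W * real q)"
      by (rule left_diff_distrib)
    also have "p (Suc n) / real q * (W * real q) = p (Suc n) * W"
      using q1 by simp
    also have "r ^ Suc n * (W * real q) = u ^ Suc n * m"
      using W0 unfolding r_def rm by (simp add: power_divide)
    also have "real_of_int (p (Suc n) * W) - real_of_int (u ^ Suc n * m)
        = real_of_int (p (Suc n) * W - u ^ Suc n * m)"
      by simp
    finally have int: "(p (Suc n) / real q - r ^ Suc n) * (W * real q)
        = real_of_int (p (Suc n) * W - u ^ Suc n * m)" .
    have "\<bar>p (Suc n) / real q - r ^ Suc n\<bar> * (W * real q)
        = \<bar>(p (Suc n) / real q - r ^ Suc n) * (W * real q)\<bar>"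
      using W0 by (simp add: abs_mult)
    then have "\<bar>real_of_int (p (Suc n) * W - u ^ Suc n * m)\<bar> < 1"
      using less_1 unfolding int by simp
    then have "p (Suc n) * W - u ^ Suc n * m = 0" by linarith
    then have eq: "p (Suc n) * W = u ^ Suc n * m" by simp
    \<comment> \<open>As \<open>W\<close> is coprime to \<open>u\<close>, it divides the cofactor
      \<open>m\<close>; this raises \<open>W ^ n dvd q\<close> to \<open>W ^ Suc n dvd q\<close> and
      carries the induction on.\<close>
    then have "W dvd u ^ Suc n * m" by (metis dvd_triv_right)
    moreover have "coprime W (u ^ Suc n)" using uW(3) by (simp add: coprime_commute)
    ultimately have "W dvd m" by (simp only: coprime_dvd_mult_right_iff)
    moreover have "p (Suc n) * W ^ Suc n = (p (Suc n) * W) * W ^ n" by simp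
    then have "p (Suc n) * W ^ Suc n = u ^ Suc n * int q" unfolding eq m by simp
    ultimately show ?case unfolding m by (simp add: mult.commute mult_dvd_mono)
  qed
  then obtain l where l: "int q = W ^ k * l" using k by (auto elim: dvdE)
  have "l > 0" using l W0 q by (metis of_nat_0_less_iff less_le_trans zero_less_one zero_less_mult_pos zero_less_power)
  show ?thesis
  proof (rule that[of u "nat W" "nat l"])
    show "q = nat l * nat W ^ k"
      using l W0 \<open>l > 0\<close> by (metis mult.commute nat_int nat_mult_distrib nat_power_eq less_imp_le)
    show "\<forall>j\<in>{1..k}. p j = int (nat l) * u ^ j * int (nat W) ^ (k - j)"
    proof
      fix j assume j: "j \<in> {1..k}"
      have "p j * W ^ j = u ^ j * (W ^ (k - j + j) * l)" using main[of j] l j by simp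
      then have "p j * W ^ j = (l * u ^ j * W ^ (k - j)) * W ^ j"
        by (simp only: power_add mult_ac)
      then show "p j = int (nat l) * u ^ j * int (nat W) ^ (k - j)"
        using W0 \<open>l > 0\<close> by simp
    qed
  qed (use uW W0 \<open>l > 0\<close> in auto)
qed

section \<open>Finiteness below the threshold \<open>1 / (b - 1)\<close>\<close>

lemma finite_approx_vectors_bounded:
  assumes "k \<ge> 1"
  shows "finite {v \<in> approx_vectors k \<Psi> \<zeta>. fst v \<le> Q}"
proof (rule finite_subset)
  let ?I = "\<lambda>q j. {\<lfloor>\<zeta> ^ j * real q - \<Psi> q\<rfloor>..\<lceil>\<zeta> ^ j * real q + \<Psi> q\<rceil>}"
  show "{v \<in> approx_vectors k \<Psi> \<zeta>. fst v \<le> Q} \<subseteq> (SIGMA q:{..Q}. PiE {1..k} (?I q))"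
  proof clarsimp
    fix q p assume "(q, p) \<in> approx_vectors k \<Psi> \<zeta>"
    then have p: "p \<in> {1..k} \<rightarrow>\<^sub>E UNIV"
      and le: "\<And>j. j \<in> {1..k} \<Longrightarrow> \<bar>\<zeta> ^ j * real q - p j\<bar> \<le> \<Psi> q"
      using mem_approx_vectors_iff[OF assms] by auto
    have "p j \<in> ?I q j" if "j \<in> {1..k}" for j
      using le[OF that] by (auto simp: floor_le_iff le_ceiling_iff)
    with p show "p \<in> PiE {Suc 0..k} (?I q)"
      by (auto simp: PiE_iff)
  qed
  show "finite (SIGMA q:{..Q}. PiE {1..k} (?I q))"
    by (intro finite_SigmaI finite_PiE) auto
qed

text \<open>The factorial \<open>D\<close> of \<open>W\<close> clears every denominator up to
  \<open>W\<close>, so a fraction near \<open>\<zeta>\<close> would put \<open>\<zeta> * D\<close>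
  near an integer; \<open>\<delta>\<close> is its distance to the nearest one, positive by
  irrationality.\<close>

lemma irrational_distance_bounded_below:
  fixes \<zeta> :: real and W :: nat
  assumes "\<zeta> \<notin> \<rat>"
  obtains \<epsilon> where "\<epsilon> > 0"
    "\<And>(u::int) w::nat. 1 \<le> w \<Longrightarrow> w \<le> W \<Longrightarrow> \<epsilon> \<le> \<bar>\<zeta> - u / w\<bar>"
proof -
  define D where "D = real (fact W)"
  have D: "D > 0" by (simp add: D_def)
  define \<delta> where "\<delta> = min (frac (\<zeta> * D)) (1 - frac (\<zeta> * D))"
  have "\<zeta> * D \<notin> \<int>"
  proof
    assume "\<zeta> * D \<in> \<int>"
    then have "\<zeta> * D \<in> \<rat>" using Ints_subset_Rats by blast
    moreover have "D \<in> \<rat>" unfolding D_def by (rule Rats_of_nat)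
    ultimately have "\<zeta> * D / D \<in> \<rat>" by (rule Rats_divide)
    then show False using assms D by simp
  qed
  then have "\<delta> > 0" by (auto simp: \<delta>_def frac_gt_0_iff frac_lt_1)
  have dist: "\<delta> \<le> \<bar>\<zeta> * D - of_int z\<bar>" for z
  proof (cases "z \<le> \<lfloor>\<zeta> * D\<rfloor>")
    case True
    then have "real_of_int z \<le> \<lfloor>\<zeta> * D\<rfloor>" by simp
    then show ?thesis unfolding \<delta>_def frac_def by linarith
  next
    case False
    then have "\<lfloor>\<zeta> * D\<rfloor> + 1 \<le> z" by simp
    then have "real_of_int \<lfloor>\<zeta> * D\<rfloor> + 1 \<le> z" by linarith
    then show ?thesis unfolding \<delta>_def frac_def by linarith
  qed
  show ?thesis
  proof (rule that[of "\<delta> / D"])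
    fix u :: int and w :: nat assume w: "1 \<le> w" "w \<le> W"
    then have "w dvd fact W" by (simp add: dvd_fact)
    then obtain m where m: "fact W = w * m" by (auto elim: dvdE)
    have "\<delta> \<le> \<bar>\<zeta> * D - of_int (u * int m)\<bar>" by (rule dist)
    also have "of_int (u * int m) = u / w * D"
      using w unfolding D_def m by simp
    also have "\<bar>\<zeta> * D - u / w * D\<bar> = \<bar>\<zeta> - u / w\<bar> * D"
      unfolding left_diff_distrib[symmetric] abs_mult using D by simp
    finally show "\<delta> / D \<le> \<bar>\<zeta> - u / w\<bar>"
      using D by (simp add: field_simps)
  qed (use \<open>\<delta> > 0\<close> D in simp)
qed

text \<open>\<open>V\<close> stands for all approximation vectors or for the primitive ones only.
  The inequality on multiples is asked only for vectors of \<open>V\<close> divisible by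
  \<open>l\<close>: in the first case it is the growth condition on \<open>\<Psi>\<close>, in the
  second it is trivial because \<open>l = 1\<close>.\<close>

lemma finite_approx_vectors_below_threshold:
  fixes N P :: "nat \<Rightarrow> nat" and \<Psi> :: "nat \<Rightarrow> real" and b k :: nat and \<zeta> :: real
  defines "\<eta> \<equiv> \<lambda>i. \<Psi> (b ^ (k * N i)) / real b ^ (k * N i)"
  assumes k: "k \<ge> 2" and b: "b \<ge> 3" and pos: "\<And>x. x \<ge> 1 \<Longrightarrow> \<Psi> x > 0"
    and small: "\<And>x. x \<ge> x0 \<Longrightarrow> \<Psi> x < 1 / (2 * real x)"
    and \<zeta>: "\<bar>\<zeta>\<bar> \<le> 1/2" "\<zeta> \<notin> \<rat>"
    and N: "strict_mono N" "N 0 \<ge> 3" "N 0 \<ge> x0" and P: "\<And>i. coprime (P i) b"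
    and upper: "\<And>i. \<bar>\<zeta> - P i / real b ^ N i\<bar> \<le> \<eta> i"
    and lower: "\<And>i. \<eta> i * (1 - 2 * real b ^ 2 * \<eta> i) \<le> (real b - 1) * \<bar>\<zeta> - P i / real b ^ N i\<bar>"
    and grow: "\<And>i. (\<eta> i)\<^sup>2 \<le> real b ^ 2 / real b ^ N (Suc i)"
    and c: "c < 1 / (real b - 1)"
    and V: "V \<subseteq> approx_vectors k (\<lambda>x. c * \<Psi> x) \<zeta>"
    and scale: "\<And>l x p. l \<ge> 1 \<Longrightarrow> x \<ge> 1 \<Longrightarrow> (l * x, p) \<in> V \<Longrightarrow> (\<And>j. j \<in> {1..k} \<Longrightarrow> int l dvd p j)
      \<Longrightarrow> \<Psi> (l * x) \<le> real l * \<Psi> x"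
  shows "finite V"
proof (rule ccontr)
  assume inf: "infinite V"
  have b3: "3 \<le> real b" using b by simp
  have k1: "k \<ge> 1" using k by simp
  have c1: "c * (real b - 1) < 1" using c b3 by (simp add: field_simps)
  \<comment> \<open>\<open>c < 1/2\<close> turns \<open>\<Psi> q < 1 / (2 * q)\<close> into the
    bound \<open>1 / (4 * q)\<close> under which a vector comes from a single fraction.\<close>
  have "1 / (real b - 1) \<le> 1 / 2" using b3 by (intro divide_left_mono) auto
  then have c2: "c < 1/2" using c by linarith
  have small': "\<Psi> (w ^ k) / real w ^ k < 1 / (2 * real w ^ 4)" if w: "w \<ge> x0" "w \<ge> 1" for w
  proof -
    have "w ^ 1 \<le> w ^ k" using w k by (intro power_increasing) auto
    then have "\<Psi> (w ^ k) < 1 / (2 * real (w ^ k))" using w by (intro small) auto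
    then have "\<Psi> (w ^ k) / real w ^ k < 1 / (2 * real w ^ k) / real w ^ k"
      using w by (intro divide_strict_right_mono) auto
    also have "\<dots> = 1 / (2 * real w ^ (k + k))" by (simp add: power_add)
    also have "\<dots> \<le> 1 / (2 * real w ^ 4)"
      using w k by (intro divide_left_mono mult_left_mono power_increasing) auto
    finally show ?thesis .
  qed
  \<comment> \<open>For \<open>w > W1\<close> the error term
    \<open>2 * b\<^sup>2 * \<eta> i\<close>, with \<open>\<eta> i < 1 / w\<close>, is smaller than
    the gap \<open>1 - c * (b - 1)\<close>.\<close>
  obtain W1 where W1: "2 * real b ^ 2 / (1 - c * (real b - 1)) < real W1"
    using reals_Archimedean2 by blast
  define W where "W = max W1 (max x0 (b ^ N 0))"
  obtain \<epsilon> where \<epsilon>: "\<epsilon> > 0" "\<And>(u::int) w::nat. 1 \<le> w \<Longrightarrow> w \<le> W \<Longrightarrow> \<epsilon> \<le> \<bar>\<zeta> - u / w\<bar>"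
    using irrational_distance_bounded_below[OF \<zeta>(2)] by metis
  \<comment> \<open>A vector with \<open>q > 1 / \<epsilon>\<close> cannot come from a denominator
    \<open>w \<le> W\<close>, since that would give
    \<open>\<epsilon> * q \<le> c * \<Psi> q < 1\<close>.\<close>
  obtain Q1 where Q1: "1 / \<epsilon> < real Q1" using reals_Archimedean2 by blast
  define Q where "Q = max x0 (max Q1 1)"
  have "\<exists>v\<in>V. Q < fst v"
  proof (rule ccontr)
    assume "\<not> ?thesis"
    then have "V \<subseteq> {v \<in> approx_vectors k (\<lambda>x. c * \<Psi> x) \<zeta>. fst v \<le> Q}" using V by force
    then show False using inf finite_approx_vectors_bounded[OF k1] finite_subset by blast
  qed
  then obtain q p where qp: "(q, p) \<in> V" "Q < q" by auto
  then have q: "q \<ge> 1" "q \<ge> x0" "1 / \<epsilon> < real q" using Q1 by (auto simp: Q_def)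
  have approx: "\<bar>\<zeta> ^ j * real q - p j\<bar> \<le> c * \<Psi> q" if "j \<in> {1..k}" for j
    using subsetD[OF V qp(1)] that unfolding mem_approx_vectors_iff[OF k1] by blast
  \<comment> \<open>The range of \<open>c\<close> contains negative numbers; these admit no vectors,
    as an absolute value is bounded by \<open>c * \<Psi> q\<close>.\<close>
  have "0 \<le> c * \<Psi> q" using order_trans[OF abs_ge_zero approx[of 1]] k1 by simp
  then have c0: "0 \<le> c" using pos[OF q(1)] by (simp add: zero_le_mult_iff)
  have c\<Psi>: "c * \<Psi> q < 1 / (4 * real q)"
  proof -
    have "c * \<Psi> q \<le> 1/2 * \<Psi> q" using c2 pos[OF q(1)] by (intro mult_right_mono) auto
    also have "\<dots> < 1/2 * (1 / (2 * real q))" using small[OF q(2)] by simp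
    finally show ?thesis by simp
  qed
  obtain u w l where uwl: "coprime u (int w)" "w \<ge> 1" "l \<ge> 1" "q = l * w ^ k"
    "\<forall>j\<in>{1..k}. p j = int l * u ^ j * int w ^ (k - j)"
    by (rule approx_vector_structure[OF k1 q(1) \<zeta>(1) le_less_trans[OF approx c\<Psi>]]) blast
  have "real q = real l * (real w ^ (k - 1) * real w)"
    using power_minus_mult[of k "real w"] k by (simp add: uwl(4))
  moreover have "p 1 = int l * u * int w ^ (k - 1)"
    using bspec[OF uwl(5), of 1] k1 by simp
  ultimately have "real_of_int (p 1) = u / w * real q"
    using uwl(2) by simp
  then have "\<bar>\<zeta> ^ 1 * real q - p 1\<bar> = \<bar>\<zeta> - u / w\<bar> * real q"
    by (simp only: power_one_right left_diff_distrib[symmetric] abs_mult abs_of_nat)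
  then have uq: "\<bar>\<zeta> - u / w\<bar> * real q \<le> c * \<Psi> q" using approx[of 1] k1 by simp
  have "W < w"
  proof (rule ccontr)
    assume "\<not> W < w"
    then have "\<epsilon> \<le> \<bar>\<zeta> - u / w\<bar>" using \<epsilon>(2) uwl(2) by simp
    then have "\<epsilon> * real q \<le> \<bar>\<zeta> - u / w\<bar> * real q" by (rule mult_right_mono) simp
    also note uq
    also have "c * \<Psi> q < 1 / (4 * real q)" by (rule c\<Psi>)
    also have "\<dots> \<le> 1" using q(1) by simp
    finally show False using q(3) \<epsilon>(1) by (simp add: field_simps)
  qed
  then have w: "w \<ge> x0" "w \<ge> b ^ N 0" "real W1 < w" by (auto simp: W_def)
  have "w ^ k \<ge> 1" using uwl(2) by simp
  have "\<Psi> q \<le> real l * \<Psi> (w ^ k)"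
    unfolding uwl(4)
  proof (rule scale)
    show "(l * w ^ k, p) \<in> V" using qp(1) uwl(4) by simp
  qed (use uwl in auto)
  then have "\<bar>\<zeta> - u / w\<bar> * (real l * real w ^ k) \<le> c * (real l * \<Psi> (w ^ k))"
    using uq c0 uwl(4) by (smt (verit) mult_left_mono of_nat_mult of_nat_power)
  then have uw: "\<bar>\<zeta> - u / w\<bar> \<le> c * (\<Psi> (w ^ k) / real w ^ k)"
    using uwl(2,3) by (simp add: field_simps)
  also have "\<dots> \<le> 1/2 * (\<Psi> (w ^ k) / real w ^ k)"
    using c2 pos[OF \<open>w ^ k \<ge> 1\<close>] by (intro mult_right_mono) auto
  also have "\<dots> < 1/2 * (1 / (2 * real w ^ 4))"
    using small'[OF w(1) uwl(2)] by simp
  finally have "\<bar>\<zeta> - u / w\<bar> < 1 / (4 * real w ^ 4)" by simp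
  moreover have "\<eta> i < 1 / (2 * real b ^ (4 * N i))" for i
  proof -
    have "x0 \<le> N i" using N(3) strict_mono_less_eq[OF N(1), of 0 i] by simp
    also have "N i \<le> b ^ N i" using b by (intro less_imp_le power_gt_expt) auto
    finally show ?thesis
      using small'[of "b ^ N i"] b unfolding \<eta>_def by (simp add: mult.commute flip: power_mult)
  qed
  ultimately have "\<exists>i. u / w = int (P i) / real b ^ N i"
    using upper grow w(2)
    by (intro approximant_is_truncation[where \<zeta> = \<zeta> and \<eta> = \<eta>, OF b N(1,2)]) auto
  then obtain i where i: "u / w = P i / real b ^ N i" by auto
  then have "real_of_int (u * int (b ^ N i)) = real_of_int (int (P i) * int w)"
    using uwl(2) b by (simp add: field_simps)
  then have eq: "u * int (b ^ N i) = int (P i) * int w" by (simp only: of_int_eq_iff)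
  \<comment> \<open>Both fractions are reduced, so their denominators divide each other.\<close>
  have "int w dvd int (b ^ N i)"
    using eq uwl(1) by (metis coprime_commute coprime_dvd_mult_right_iff dvd_triv_right)
  moreover have "coprime (int (b ^ N i)) (int (P i))"
    using P[of i] by (simp add: coprime_commute del: of_nat_power)
  then have "int (b ^ N i) dvd int w"
    using eq by (metis coprime_dvd_mult_right_iff dvd_triv_right)
  ultimately have "w = b ^ N i" by (simp add: dvd_antisym del: of_nat_power)
  then have wk: "\<Psi> (w ^ k) / real w ^ k = \<eta> i"
    by (simp add: \<eta>_def mult.commute flip: power_mult)
  have \<eta>0: "0 < \<eta> i" unfolding wk[symmetric] using pos[OF \<open>w ^ k \<ge> 1\<close>] uwl(2) by simp
  \<comment> \<open>The distance to the truncation is at most \<open>c * \<eta> i\<close> and at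
    least about \<open>\<eta> i / (b - 1)\<close>, which contradicts the choice of \<open>c\<close>
    once \<open>\<eta> i\<close> is cancelled.\<close>
  have "\<eta> i * (1 - 2 * real b ^ 2 * \<eta> i) \<le> (real b - 1) * (c * \<eta> i)"
    using lower[of i] uw b3 unfolding wk i by (smt (verit) mult_left_mono)
  then have "\<eta> i * (1 - 2 * real b ^ 2 * \<eta> i) \<le> \<eta> i * (c * (real b - 1))"
    by (simp only: mult_ac)
  then have "1 - 2 * real b ^ 2 * \<eta> i \<le> c * (real b - 1)"
    using \<eta>0 by simp
  moreover have "2 * real b ^ 2 * \<eta> i < 1 - c * (real b - 1)"
  proof -
    have "real w ^ 1 \<le> real w ^ 4" using uwl(2) by (intro power_increasing) auto
    then have "real w \<le> 2 * real w ^ 4" unfolding power_one_right by linarith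
    then have "1 / (2 * real w ^ 4) \<le> 1 / real w" using uwl(2) by (intro divide_left_mono) auto
    then have "\<eta> i < 1 / real w" using small'[OF w(1) uwl(2)] unfolding wk by linarith
    then have "2 * real b ^ 2 * \<eta> i < 2 * real b ^ 2 * (1 / real w)"
      using b3 by (intro mult_strict_left_mono) auto
    also have "\<dots> < 1 - c * (real b - 1)"
    proof -
      have "2 * real b ^ 2 / (1 - c * (real b - 1)) < real w" using W1 w(3) by linarith
      then show ?thesis using c1 uwl(2) by (simp add: field_simps)
    qed
    finally show ?thesis .
  qed
  ultimately show False by linarith
qed

section \<open>Gluing the blocks into a family of digit sets\<close>

text \<open>The next position \<open>L n\<close> depends on \<open>n\<close> alone, so one
  \<open>N\<close> serves all \<open>A\<close>. The set \<open>A\<close> only switches the digit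
  just before each block end and can be read off from \<open>X A\<close>.\<close>

lemma digit_set_family_exists:
  fixes b N0 :: nat and \<eta> :: "nat \<Rightarrow> real"
  assumes b: "b \<ge> 3" and N0: "N0 \<ge> 1"
    and \<eta>: "\<And>n. n \<ge> N0 \<Longrightarrow> 0 < \<eta> n \<and> \<eta> n < 1 / real b ^ (4 * n)"
  obtains N :: "nat \<Rightarrow> nat" and X :: "nat set \<Rightarrow> nat set" where
    "N 0 = N0" "strict_mono N" "inj X" "\<forall>A. X A \<subseteq> {0<..}" "\<forall>A i. N i \<in> X A"
    "\<forall>A i. digit_val b (X A) - digit_sum b (X A) (N i) \<le> \<eta> (N i)"
    "\<forall>A i. \<eta> (N i) * (1 - 2 * real b ^ 2 * \<eta> (N i))
       \<le> (real b - 1) * (digit_val b (X A) - digit_sum b (X A) (N i))"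
    "\<forall>i. (\<eta> (N i))\<^sup>2 \<le> real b ^ 2 / real b ^ N (Suc i)"
proof -
  have b3: "3 \<le> real b" using b by simp
  have "\<exists>L Y. Y \<subseteq> {n<..<L - 1} \<and> n + 2 \<le> L \<and>
      (\<Sum>i\<in>Y. 1 / real b ^ i) + 2 * real b / real b ^ L \<le> \<eta> n \<and>
      \<eta> n - 2 * real b ^ 2 / real b ^ L \<le> (real b - 1) * (\<Sum>i\<in>Y. 1 / real b ^ i) \<and>
      1 / real b ^ L \<le> (\<eta> n)\<^sup>2 \<and> (\<eta> n)\<^sup>2 \<le> real b ^ 2 / real b ^ L" if n: "n \<ge> N0" for n
  proof -
    have "1 \<le> n" using n N0 by simp
    from block_exists[OF b this conjunct1[OF \<eta>[OF n]] conjunct2[OF \<eta>[OF n]]]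
    show ?thesis by metis
  qed
  then obtain L Y where LY: "\<And>n. n \<ge> N0 \<Longrightarrow> Y n \<subseteq> {n<..<L n - 1} \<and> n + 2 \<le> L n \<and>
      (\<Sum>i\<in>Y n. 1 / real b ^ i) + 2 * real b / real b ^ L n \<le> \<eta> n \<and>
      \<eta> n - 2 * real b ^ 2 / real b ^ L n \<le> (real b - 1) * (\<Sum>i\<in>Y n. 1 / real b ^ i) \<and>
      1 / real b ^ L n \<le> (\<eta> n)\<^sup>2 \<and> (\<eta> n)\<^sup>2 \<le> real b ^ 2 / real b ^ L n"
    by metis
  define N where "N i = (L ^^ i) N0" for i
  have N_Suc: "N (Suc i) = L (N i)" for i by (simp add: N_def)
  have N_ge: "N0 \<le> N i" for i
  proof (induction i)
    case (Suc i)
    then show ?case using LY[OF Suc] by (simp add: N_Suc)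
  qed (simp add: N_def)
  have step: "N i + 2 \<le> N (Suc i)" for i
    using LY[OF N_ge[of i]] by (simp add: N_Suc)
  have mono: "strict_mono N"
    unfolding strict_mono_Suc_iff using step by (metis add_2_eq_Suc' less_eq_Suc_le Suc_leD)
  define B where "B A i = Y (N i) \<union> {N (Suc i)} \<union> (if i \<in> A then {N (Suc i) - 1} else {})" for A i
  define X where "X A = insert N0 (\<Union>i. B A i)" for A
  have Y_sub: "Y (N i) \<subseteq> {N i<..<N (Suc i) - 1}" for i
    using LY[OF N_ge[of i]] by (simp add: N_Suc)
  have B_sub: "B A i \<subseteq> {N i<..N (Suc i)}" for A i
    using Y_sub[of i] step[of i] by (auto simp: B_def subset_iff less_diff_conv)
  have block: "X A \<inter> {N i<..N (Suc i)} = B A i" for A i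
  proof
    show "B A i \<subseteq> X A \<inter> {N i<..N (Suc i)}" using B_sub by (auto simp: X_def)
    show "X A \<inter> {N i<..N (Suc i)} \<subseteq> B A i"
    proof
      fix x assume x: "x \<in> X A \<inter> {N i<..N (Suc i)}"
      then have "x \<noteq> N0" using N_ge[of i] by auto
      then obtain j where j: "x \<in> B A j" using x by (auto simp: X_def)
      then have "N j < x" "x \<le> N (Suc j)" using B_sub by (auto simp: subset_iff)
      then have "N j < N (Suc i)" "N i < N (Suc j)" using x by auto
      then have "j = i" using strict_mono_less[OF mono] by (metis less_antisym less_SucE less_asym)
      then show "x \<in> B A i" using j by simp
    qed
  qed
  have N_mem: "N i \<in> X A" for A i
  proof (cases i)
    case 0
    then show ?thesis by (simp add: X_def N_def)
  next
    case (Suc j)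
    then show ?thesis by (auto simp: X_def B_def)
  qed
  have tail: "digit_val b (X A) - digit_sum b (X A) (N (Suc i)) \<le> 1 / real b ^ N (Suc i)" for A i
  proof -
    have "1 / ((real b - 1) * real b ^ N (Suc i)) \<le> 1 / real b ^ N (Suc i)"
      using b3 by (intro divide_left_mono) auto
    then show ?thesis using digit_val_bounds(2)[of b "X A" "N (Suc i)"] b by linarith
  qed
  have split: "digit_sum b (X A) (N (Suc i)) = digit_sum b (X A) (N i) + (\<Sum>x\<in>B A i. 1 / real b ^ x)" for A i
    using digit_sum_diff[of "N i" "N (Suc i)" b "X A"] step[of i] unfolding block by simp
  have fin: "finite (B A i)" for A i using B_sub by (rule finite_subset) simp
  have finY: "finite (Y (N i))" for i
    by (rule finite_subset[OF _ fin[of "{}" i]]) (auto simp: B_def)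
  show ?thesis
  proof (rule that[of N X])
    show "N 0 = N0" by (simp add: N_def)
    show "strict_mono N" by (rule mono)
    show "inj X"
    proof (rule injI)
      fix A A' assume eq: "X A = X A'"
      have mem: "i \<in> A \<longleftrightarrow> N (Suc i) - 1 \<in> X A \<inter> {N i<..N (Suc i)}" for i A
        unfolding block using Y_sub[of i] step[of i] by (auto simp: B_def)
      show "A = A'"
        by (rule set_eqI) (simp only: mem[of _ A] mem[of _ A'] eq)
    qed
    show "\<forall>A. X A \<subseteq> {0<..}"
      using N0 B_sub by (fastforce simp: X_def)
    show "\<forall>A i. N i \<in> X A" by (simp add: N_mem)
    show "\<forall>A i. digit_val b (X A) - digit_sum b (X A) (N i) \<le> \<eta> (N i)"
    proof (intro allI)
      fix A i
      define t where "t = 1 / real b ^ N (Suc i)"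
      have t: "1 / real b ^ (N (Suc i) - 1) = real b * t"
        using step[of i] b3 unfolding t_def by (cases "N (Suc i)") auto
      have t0: "0 < t" using b3 by (simp add: t_def)
      have not_in_Y: "N (Suc i) \<notin> Y (N i)" "N (Suc i) - 1 \<notin> Y (N i)"
        using subsetD[OF Y_sub[of i], of "N (Suc i)"] subsetD[OF Y_sub[of i], of "N (Suc i) - 1"] by auto
      \<comment> \<open>The free digit is counted as present: \<open>b * t\<close> for it,
        \<open>t\<close> for the block end and at most \<open>t\<close> for the tail fit into the
        reserve \<open>2 * b * t\<close>.\<close>
      have "(\<Sum>x\<in>B A i. 1 / real b ^ x) \<le> (\<Sum>x\<in>Y (N i) \<union> {N (Suc i), N (Suc i) - 1}. 1 / real b ^ x)"
        using finY by (intro sum_mono2) (auto simp: B_def)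
      also have "\<dots> = (\<Sum>x\<in>Y (N i). 1 / real b ^ x) + (\<Sum>x\<in>{N (Suc i), N (Suc i) - 1}. 1 / real b ^ x)"
        using finY not_in_Y by (intro sum.union_disjoint) auto
      also have "(\<Sum>x\<in>{N (Suc i), N (Suc i) - 1}. 1 / real b ^ x) = t + real b * t"
        using step[of i] t by (subst sum.insert) (auto simp: t_def)
      finally have "digit_val b (X A) - digit_sum b (X A) (N i)
          \<le> (\<Sum>x\<in>Y (N i). 1 / real b ^ x) + (2 * t + real b * t)"
        using split[of A i] tail[of A i] unfolding t_def by linarith
      also have "2 * t + real b * t \<le> 2 * real b / real b ^ N (Suc i)"
        using b3 t0 mult_right_mono[of 2 "real b" t] by (simp add: t_def)
      finally show "digit_val b (X A) - digit_sum b (X A) (N i) \<le> \<eta> (N i)"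
        using LY[OF N_ge[of i]] by (simp add: N_Suc)
    qed
    show "\<forall>A i. \<eta> (N i) * (1 - 2 * real b ^ 2 * \<eta> (N i))
       \<le> (real b - 1) * (digit_val b (X A) - digit_sum b (X A) (N i))"
    proof (intro allI)
      fix A i
      have "(\<Sum>x\<in>Y (N i). 1 / real b ^ x) \<le> (\<Sum>x\<in>B A i. 1 / real b ^ x)"
        using fin by (intro sum_mono2) (auto simp: B_def)
      also have "\<dots> \<le> digit_val b (X A) - digit_sum b (X A) (N i)"
        using split[of A i] digit_val_bounds(1)[of b "X A" "N (Suc i)"] b by simp
      finally have "(real b - 1) * (\<Sum>x\<in>Y (N i). 1 / real b ^ x)
          \<le> (real b - 1) * (digit_val b (X A) - digit_sum b (X A) (N i))"
        using b3 by (intro mult_left_mono) auto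
      \<comment> \<open>\<open>1 / b ^ L \<le> \<eta>\<^sup>2\<close> converts the additive error
        \<open>2 * b\<^sup>2 / b ^ L\<close> of the block into the relative error
        \<open>2 * b\<^sup>2 * \<eta>\<close>.\<close>
      moreover have "2 * real b ^ 2 * (1 / real b ^ L (N i)) \<le> 2 * real b ^ 2 * (\<eta> (N i))\<^sup>2"
        using LY[OF N_ge[of i]] by (intro mult_left_mono) auto
      moreover have "\<eta> (N i) * (1 - 2 * real b ^ 2 * \<eta> (N i)) = \<eta> (N i) - 2 * real b ^ 2 * (\<eta> (N i))\<^sup>2"
        by (simp add: algebra_simps power2_eq_square)
      ultimately show "\<eta> (N i) * (1 - 2 * real b ^ 2 * \<eta> (N i))
          \<le> (real b - 1) * (digit_val b (X A) - digit_sum b (X A) (N i))"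
        using LY[OF N_ge[of i]] by simp
    qed
    show "\<forall>i. (\<eta> (N i))\<^sup>2 \<le> real b ^ 2 / real b ^ N (Suc i)"
      using LY[OF N_ge] by (simp add: N_Suc)
  qed
qed

section \<open>Uncountably many transcendental examples\<close>

text \<open>The range of \<open>f\<close> stays uncountable after its countably many algebraic
  values are discarded, so membership in \<open>S\<close> needs checking only at transcendental
  values.\<close>

lemma uncountable_if_contains_transcendental_values:
  fixes f :: "nat set \<Rightarrow> real"
  assumes "inj f" and "\<And>A. \<not> algebraic (f A) \<Longrightarrow> f A \<in> S"
  shows "uncountable S"
proof -
  have "uncountable (range f)"
    using uncountable_UNIV_nat_set assms(1) countable_image_inj_on by blast
  then have "uncountable (range f - {x. algebraic x})"
    using countable_algebraic by (rule uncountable_minus_countable)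
  moreover have "range f - {x. algebraic x} \<subseteq> S" using assms(2) by auto
  ultimately show ?thesis using countable_subset by blast
qed

theorem theorem2p9:
  fixes k b :: nat and \<Psi> :: "nat \<Rightarrow> real"
  assumes "k \<ge> 2" and "b \<ge> 3"
    and "\<And>x. x \<ge> 1 \<Longrightarrow> \<Psi> x > 0"
    and "\<forall>\<^sub>F x in sequentially. \<Psi> x < 1 / 2 * (1 / real x)"
  shows "((\<forall>l\<ge>1. \<forall>x\<ge>1. \<Psi> (l * x) \<le> real l * \<Psi> x) \<longrightarrow>
            uncountable ((approximable k \<Psi> -
              (\<Union>c\<in>{..<1 / (real b - 1)}. approximable k (\<lambda>x. c * \<Psi> x))) \<inter> cantor_01 b))
         \<and> uncountable ((approximable_primitive k \<Psi> -
              (\<Union>c\<in>{..<1 / (real b - 1)}. approximable_primitive k (\<lambda>x. c * \<Psi> x))) \<inter> cantor_01 b)"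
proof -
  have b3: "3 \<le> real b" using assms(2) by simp
  obtain x0 where x0: "\<And>x. x \<ge> x0 \<Longrightarrow> \<Psi> x < 1 / (2 * real x)"
    using assms(4) by (auto simp: eventually_sequentially)
  \<comment> \<open>The 3 ensures \<open>2 * b\<^sup>2 < b ^ N i\<close> when fractions are
    identified with truncations; \<open>x0\<close> puts all positions where \<open>\<Psi>\<close> is
    small.\<close>
  define N0 where "N0 = max 3 x0"
  define \<eta> where "\<eta> n = \<Psi> (b ^ (k * n)) / real b ^ (k * n)" for n
  have \<eta>: "0 < \<eta> n \<and> \<eta> n < 1 / real b ^ (4 * n)" if n: "n \<ge> N0" for n
  proof
    have pos: "1 \<le> b ^ (k * n)" using assms(2) by simp
    then show "0 < \<eta> n" using assms(3)[OF pos] b3 unfolding \<eta>_def by simp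
    have "x0 \<le> k * n" using n assms(1) by (simp add: N0_def trans_le_add1 order_trans[of x0 n "k * n"])
    also have "\<dots> \<le> b ^ (k * n)" using assms(2) by (intro less_imp_le power_gt_expt) auto
    finally have "\<Psi> (b ^ (k * n)) < 1 / (2 * real (b ^ (k * n)))" by (rule x0)
    then have "\<eta> n < 1 / (2 * real (b ^ (k * n))) / real b ^ (k * n)"
      unfolding \<eta>_def using b3 by (intro divide_strict_right_mono) auto
    also have "\<dots> = 1 / (2 * real b ^ (k * n + k * n))" by (simp add: power_add)
    also have "\<dots> \<le> 1 / real b ^ (4 * n)"
    proof (rule divide_left_mono)
      \<comment> \<open>\<open>k \<ge> 2\<close> supplies the exponent 4 that the block construction
        asks for.\<close>
      have "4 * n \<le> k * n + k * n" using mult_le_mono1[OF assms(1), of n] by linarith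
      then have "real b ^ (4 * n) \<le> real b ^ (k * n + k * n)" using b3 by (intro power_increasing) auto
      also have "\<dots> \<le> 2 * real b ^ (k * n + k * n)" using b3 by simp
      finally show "real b ^ (4 * n) \<le> 2 * real b ^ (k * n + k * n)" .
    qed (use b3 in auto)
    finally show "\<eta> n < 1 / real b ^ (4 * n)" .
  qed
  have "N0 \<ge> 1" by (simp add: N0_def)
  obtain N and X :: "nat set \<Rightarrow> nat set" where N: "N 0 = N0" "strict_mono N" and X: "inj X" "\<forall>A. X A \<subseteq> {0<..}" "\<forall>A i. N i \<in> X A"
    and upper: "\<forall>A i. digit_val b (X A) - digit_sum b (X A) (N i) \<le> \<eta> (N i)"
    and lower: "\<forall>A i. \<eta> (N i) * (1 - 2 * real b ^ 2 * \<eta> (N i))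
       \<le> (real b - 1) * (digit_val b (X A) - digit_sum b (X A) (N i))"
    and grow: "\<forall>i. (\<eta> (N i))\<^sup>2 \<le> real b ^ 2 / real b ^ N (Suc i)"
    by (rule digit_set_family_exists[OF assms(2) \<open>N0 \<ge> 1\<close> \<eta>]) blast
  define \<zeta> where "\<zeta> A = digit_val b (X A)" for A
  define P where "P A i = digit_num b (X A) (N i)" for A i
  have \<zeta>_half: "\<bar>\<zeta> A\<bar> \<le> 1/2" and \<zeta>_cantor: "\<zeta> A \<in> cantor_01 b" for A
    using digit_val_in_cantor_01[OF assms(2), of "X A"] unfolding \<zeta>_def by auto
  have sum_eq: "digit_sum b (X A) (N i) = P A i / real b ^ N i" for A i
    unfolding P_def using assms(2) by (intro digit_sum_eq_digit_num) simp
  have P_le: "P A i / real b ^ N i \<le> \<zeta> A" for A i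
    using digit_val_bounds(1)[of b "X A" "N i"] assms(2) by (simp add: sum_eq \<zeta>_def)
  have cop: "coprime (P A i) b" for A i
    unfolding P_def using X by (intro coprime_digit_num) auto
  have inj: "inj \<zeta>"
    unfolding \<zeta>_def using inj_digit_val[OF assms(2)] X
    by (metis (mono_tags, lifting) PowI injD injI inj_onD)
  have prim: "infinite (approx_vectors k \<Psi> (\<zeta> A) \<inter> primitive_vectors k)" for A
    using assms(1,2) \<zeta>_half cop P_le upper[rule_format, of A] unfolding \<eta>_def sum_eq \<zeta>_def[symmetric]
    by (intro infinite_primitive_vectors[OF _ _ N(2), where P = "P A" and b = b]) auto
  have fin: "finite V"
    if "\<not> algebraic (\<zeta> A)" "c < 1 / (real b - 1)" "V \<subseteq> approx_vectors k (\<lambda>x. c * \<Psi> x) (\<zeta> A)"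
      "\<And>l x p. l \<ge> 1 \<Longrightarrow> x \<ge> 1 \<Longrightarrow> (l * x, p) \<in> V \<Longrightarrow> (\<And>j. j \<in> {1..k} \<Longrightarrow> int l dvd p j)
        \<Longrightarrow> \<Psi> (l * x) \<le> real l * \<Psi> x" for A c V
  proof (rule finite_approx_vectors_below_threshold[OF assms(1-3) x0 \<zeta>_half _ N(2) _ _ cop _ _ _ that(2-4)])
    show "\<zeta> A \<notin> \<rat>" using that(1) rat_imp_algebraic by blast
    show "3 \<le> N 0" "x0 \<le> N 0" by (simp_all add: N(1) N0_def)
    fix i
    have abs: "\<bar>\<zeta> A - P A i / real b ^ N i\<bar> = \<zeta> A - P A i / real b ^ N i"
      using P_le[of A i] by simp
    show "\<bar>\<zeta> A - P A i / real b ^ N i\<bar> \<le> \<Psi> (b ^ (k * N i)) / real b ^ (k * N i)"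
      using upper[rule_format, of A i] unfolding abs \<eta>_def sum_eq \<zeta>_def[symmetric] .
    show "\<Psi> (b ^ (k * N i)) / real b ^ (k * N i) *
        (1 - 2 * real b ^ 2 * (\<Psi> (b ^ (k * N i)) / real b ^ (k * N i)))
        \<le> (real b - 1) * \<bar>\<zeta> A - P A i / real b ^ N i\<bar>"
      using lower[rule_format, of i A] unfolding abs \<eta>_def sum_eq \<zeta>_def[symmetric] .
    show "(\<Psi> (b ^ (k * N i)) / real b ^ (k * N i))\<^sup>2 \<le> real b ^ 2 / real b ^ N (Suc i)"
      using grow[rule_format, of i] unfolding \<eta>_def .
  qed
  show ?thesis
  proof (intro conjI impI)
    assume scale: "\<forall>l\<ge>1. \<forall>x\<ge>1. \<Psi> (l * x) \<le> real l * \<Psi> x"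
    show "uncountable ((approximable k \<Psi> -
        (\<Union>c\<in>{..<1 / (real b - 1)}. approximable k (\<lambda>x. c * \<Psi> x))) \<inter> cantor_01 b)"
    proof (rule uncountable_if_contains_transcendental_values[OF inj])
      fix A assume A: "\<not> algebraic (\<zeta> A)"
      have "finite (approx_vectors k (\<lambda>x. c * \<Psi> x) (\<zeta> A))" if "c < 1 / (real b - 1)" for c
        using scale by (intro fin[OF A that]) auto
      moreover have "infinite (approx_vectors k \<Psi> (\<zeta> A))"
        using prim[of A] by blast
      ultimately show "\<zeta> A \<in> (approximable k \<Psi> -
          (\<Union>c\<in>{..<1 / (real b - 1)}. approximable k (\<lambda>x. c * \<Psi> x))) \<inter> cantor_01 b"
        using \<zeta>_cantor[of A] A unfolding approximable_def non_algebraic_upto_def by blast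
    qed
  next
    show "uncountable ((approximable_primitive k \<Psi> -
        (\<Union>c\<in>{..<1 / (real b - 1)}. approximable_primitive k (\<lambda>x. c * \<Psi> x))) \<inter> cantor_01 b)"
    proof (rule uncountable_if_contains_transcendental_values[OF inj])
      fix A assume A: "\<not> algebraic (\<zeta> A)"
      have "finite (approx_vectors k (\<lambda>x. c * \<Psi> x) (\<zeta> A) \<inter> primitive_vectors k)"
        if "c < 1 / (real b - 1)" for c
      proof (rule fin[OF A that])
        fix l x p
        assume l: "l \<ge> 1" "(l * x, p) \<in> approx_vectors k (\<lambda>x. c * \<Psi> x) (\<zeta> A) \<inter> primitive_vectors k"
          and dvd: "\<And>j. j \<in> {1..k} \<Longrightarrow> int l dvd p j"
        have "int l dvd Gcd (insert (int (l * x)) (p ` {1..k}))"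
          using dvd by (intro Gcd_greatest) auto
        moreover have "Gcd (insert (int (l * x)) (p ` {1..k})) = 1"
          using l(2) unfolding primitive_vectors_def by blast
        ultimately have "int l dvd 1" by metis
        then have "l = 1" by simp
        then show "\<Psi> (l * x) \<le> real l * \<Psi> x" by simp
      qed simp
      then show "\<zeta> A \<in> (approximable_primitive k \<Psi> -
          (\<Union>c\<in>{..<1 / (real b - 1)}. approximable_primitive k (\<lambda>x. c * \<Psi> x))) \<inter> cantor_01 b"
        using \<zeta>_cantor[of A] A prim[of A]
        unfolding approximable_primitive_def non_algebraic_upto_def by blast
    qed
  qed
qed

end
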